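(* Let $R$ be a commutative ring with unity, $Y\subseteq\mathrm{Spec}(R)$ and $I$ an ideal of $R$. If $I$ is an $\mathcal{H}_Y$-ideal and $P\in\mathrm{Min}(I)$, then $P$ is an $\mathcal{H}_Y$-ideal. If $I$ is a strong $\mathcal{H}_Y$-ideal and $P\in\mathrm{Min}(I)$, then $P$ is a strong $\mathcal{H}_Y$-ideal.
   Context: $h_Y(S)=\{P\in Y: S\subseteq P\}$ for $S\subseteq R$, and $h_Y(a)=h_Y(\{a\})$. An ideal $I$ of $R$ (not necessarily proper) is an $\mathcal{H}_Y$-ideal if $a\in I$, $b\in R$ and $h_Y(a)\subseteq h_Y(b)$ imply $b\in I$. It is a strong $\mathcal{H}_Y$-ideal if for every finite subset $F\subseteq I$ and every $b\in R$, $h_Y(F)\subseteq h_Y(b)$ implies $b\in I$. $\mathrm{Min}(I)$ is the set of prime ideals minimal over $I$. *)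

theory Defs
  imports "HOL-Algebra.Ideal"
begin

definition Spec :: "('a, 'b) ring_scheme \<Rightarrow> 'a set set" where
  "Spec R = {P. primeideal P R}"

definition h_set :: "'a set set \<Rightarrow> 'a set \<Rightarrow> 'a set set" where
  "h_set Y S = {P \<in> Y. S \<subseteq> P}"

definition HY_ideal :: "('a, 'b) ring_scheme \<Rightarrow> 'a set set \<Rightarrow> 'a set \<Rightarrow> bool" where
  "HY_ideal R Y I \<longleftrightarrow> ideal I R \<and>
     (\<forall>a\<in>I. \<forall>b\<in>carrier R. h_set Y {a} \<subseteq> h_set Y {b} \<longrightarrow> b \<in> I)"

(* The empty set is an admissible F, with h_set Y {} = Y. *)
definition strong_HY_ideal :: "('a, 'b) ring_scheme \<Rightarrow> 'a set set \<Rightarrow> 'a set \<Rightarrow> bool" where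
  "strong_HY_ideal R Y I \<longleftrightarrow> ideal I R \<and>
     (\<forall>F b. finite F \<and> F \<subseteq> I \<and> b \<in> carrier R \<and> h_set Y F \<subseteq> h_set Y {b} \<longrightarrow> b \<in> I)"

definition Min_primes :: "('a, 'b) ring_scheme \<Rightarrow> 'a set \<Rightarrow> 'a set set" where
  "Min_primes R I = {P \<in> Spec R. I \<subseteq> P \<and> (\<forall>Q\<in>Spec R. I \<subseteq> Q \<and> Q \<subseteq> P \<longrightarrow> Q = P)}"

end

(* A prime P is minimal over I exactly when every a in P satisfies c a^n \<in> I for some c outside P
   (Krull's separation of I from the multiplicative set of all c a^n). For a finite F \<subseteq> P one c
   serves all of F. A prime of Y containing all these products c a^n contains c or F, hence
   contains c b whenever h_Y(F) \<subseteq> h_Y(b). The ideal property of I gives c b \<in> I \<subseteq> P, so b \<in> P. *)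
theory Submission
  imports Defs "HOL-Algebra.Ring_Divisibility"
begin

text \<open>Krull's separation lemma: Zorn yields an ideal \<open>M\<close> maximal among those over
  \<open>I\<close> that miss \<open>S\<close>, and maximality forces \<open>M\<close> to be prime.
  If \<open>a\<close> and \<open>b\<close> lie outside \<open>M\<close>, both \<open>M + (a)\<close>
  and \<open>M + (b)\<close> meet \<open>S\<close>; multiplying the two elements found there shows
  that \<open>a \<otimes> b\<close> in \<open>M\<close> would make \<open>M\<close> meet
  \<open>S\<close>.\<close>

lemma (in cring) exists_primeideal_disjoint_submonoid:
  assumes I: "ideal I R" and S: "submonoid S R" and disj: "I \<inter> S = {}"
  obtains Q where "primeideal Q R" "I \<subseteq> Q" "Q \<inter> S = {}"
proof -
  define A where "A = {J. ideal J R \<and> I \<subseteq> J \<and> J \<inter> S = {}}"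
  have "\<exists>M\<in>A. \<forall>X\<in>A. M \<subseteq> X \<longrightarrow> X = M"
  proof (rule subset_Zorn_nonempty)
    show "A \<noteq> {}"
      using I disj by (auto simp: A_def)
  next
    fix C assume C: "C \<noteq> {}" "subset.chain A C"
    have "subset.chain {J. ideal J R} C"
      using C(2) by (auto simp: A_def subset.chain_def)
    then have "ideal (\<Union>C) R"
      using chain_Union_is_ideal[of C] C(1) by simp
    moreover have "\<forall>J\<in>C. I \<subseteq> J \<and> J \<inter> S = {}"
      using C(2) by (auto simp: A_def subset.chain_def)
    ultimately show "\<Union>C \<in> A"
      using C(1) by (auto simp: A_def)
  qed
  then obtain M where MA: "M \<in> A" and maxA: "\<forall>X\<in>A. M \<subseteq> X \<longrightarrow> X = M"
    by (elim bexE)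
  have M: "ideal M R" "I \<subseteq> M" "M \<inter> S = {}"
    using MA by (simp_all add: A_def)
  have max: "J = M" if "ideal J R" "I \<subseteq> J" "J \<inter> S = {}" "M \<subseteq> J" for J
    using maxA that by (simp add: A_def)
  interpret M: ideal M R by fact
  interpret S: submonoid S R by fact
  \<comment> \<open>The ideal \<open>M + (x)\<close> contains \<open>M\<close> (take
    \<open>r = \<zero>\<close>) and \<open>x\<close> (take \<open>i = \<zero>\<close>,
    \<open>r = \<one>\<close>). It is strictly larger than \<open>M\<close>, so by maximality it
    cannot miss \<open>S\<close>.\<close>
  have meets: "\<exists>i\<in>M. \<exists>r\<in>carrier R. i \<oplus> r \<otimes> x \<in> S" if x: "x \<in> carrier R" "x \<notin> M" for x
  proof -
    let ?J = "set_add R M (PIdl x)"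
    have J: "ideal ?J R"
      by (intro add_ideals M(1) cgenideal_ideal x(1))
    have mem: "i \<oplus> r \<otimes> x \<in> ?J" if "i \<in> M" "r \<in> carrier R" for i r
      using that by (auto simp: set_add_def' cgenideal_def)
    have "i \<in> ?J" if "i \<in> M" for i
      using mem[OF that zero_closed] x(1) M.Icarr[OF that] by simp
    then have "M \<subseteq> ?J" by blast
    moreover have "x \<in> ?J"
      using mem[OF M.zero_closed one_closed] x(1) by simp
    ultimately have "?J \<inter> S \<noteq> {}"
      using max[OF J] M(2) x(2) by blast
    then show ?thesis
      by (auto simp: set_add_def' cgenideal_def)
  qed
  have "primeideal M R"
  proof (rule primeidealI[OF M(1) is_cring])
    show "carrier R \<noteq> M"
      using M(3) S.one_closed by auto
  next
    fix a b assume ab: "a \<in> carrier R" "b \<in> carrier R" "a \<otimes> b \<in> M"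
    show "a \<in> M \<or> b \<in> M"
    proof (rule ccontr)
      assume "\<not> (a \<in> M \<or> b \<in> M)"
      then obtain i r j s where i: "i \<in> M" "r \<in> carrier R" "i \<oplus> r \<otimes> a \<in> S"
        and j: "j \<in> M" "s \<in> carrier R" "j \<oplus> s \<otimes> b \<in> S"
        using meets ab by metis
      note carr = ab(1,2) i(2) j(2) M.Icarr[OF i(1)] M.Icarr[OF j(1)]
      \<comment> \<open>Grouped so that each of the three summands has a factor in \<open>M\<close>:
        \<open>i\<close>, \<open>j\<close> and \<open>a \<otimes> b\<close>.\<close>
      have "(i \<oplus> r \<otimes> a) \<otimes> (j \<oplus> s \<otimes> b)
          = i \<otimes> (j \<oplus> s \<otimes> b) \<oplus> (r \<otimes> a) \<otimes> j \<oplus> (r \<otimes> s) \<otimes> (a \<otimes> b)"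
        using carr by algebra
      also have "\<dots> \<in> M"
        using carr by (intro M.a_closed M.I_r_closed[OF i(1)] M.I_l_closed[OF j(1)]
          M.I_l_closed[OF ab(3)]) auto
      finally show False
        using S.m_closed[OF i(3) j(3)] M(3) by blast
    qed
  qed
  then show thesis
    using that M by blast
qed

lemma (in primeideal) one_notin: "\<one> \<notin> I"
  using I_notcarr one_imp_carrier by blast

lemma (in primeideal) nat_pow_mem:
  fixes n :: nat
  assumes "a \<in> carrier R" "a [^] n \<in> I"
  shows "a \<in> I"
  using assms(2)
proof (induction n)
  \<comment> \<open>Vacuous, since \<open>a [^] 0\<close> is \<open>\<one>\<close> and
    \<open>I\<close> is proper; exponent 0 can therefore be allowed in all later statements.\<close>
  case 0
  then show ?case using one_notin by simp
next
  case (Suc n)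
  then show ?case using I_prime[of "a [^] n" a] assms(1) by auto
qed

text \<open>In the localization at \<open>P\<close>, the only prime over the extension of
  \<open>I\<close> is that of \<open>P\<close>, so \<open>a\<close> is nilpotent modulo this
  extension. The argument below avoids fractions.\<close>

lemma (in cring) minimal_prime_annihilator:
  assumes I: "ideal I R" and P: "P \<in> Min_primes R I" and a: "a \<in> P"
  shows "\<exists>c \<in> carrier R - P. \<exists>n::nat. c \<otimes> a [^] n \<in> I"
proof (rule ccontr)
  assume no: "\<not> ?thesis"
  have "primeideal P R"
    and min: "\<And>Q. \<lbrakk>primeideal Q R; I \<subseteq> Q; Q \<subseteq> P\<rbrakk> \<Longrightarrow> Q = P"
    using P by (auto simp: Min_primes_def Spec_def)
  then interpret P: primeideal P R by simp
  have ac: "a \<in> carrier R" using a P.Icarr by blast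
  \<comment> \<open>The submonoid generated by \<open>a\<close> and the complement of
    \<open>P\<close>. Its elements with \<open>n = 0\<close> force a prime missing \<open>S\<close>
    into \<open>P\<close>, while \<open>c = \<one>\<close>, \<open>n = 1\<close> keeps
    \<open>a\<close> out of that prime.\<close>
  define S where "S = {c \<otimes> a [^] (n::nat) | c n. c \<in> carrier R - P}"
  have SI: "c \<otimes> a [^] n \<in> S" if "c \<in> carrier R" "c \<notin> P" for c and n :: nat
    using that by (auto simp: S_def)
  have "submonoid S R"
  proof
    show "S \<subseteq> carrier R" using ac by (auto simp: S_def)
    show "\<one> \<in> S" using SI[OF one_closed P.one_notin, of 0] by simp
  next
    fix x y assume "x \<in> S" "y \<in> S"
    then obtain c m d n where x: "x = c \<otimes> a [^] (m::nat)" "c \<in> carrier R" "c \<notin> P"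
      and y: "y = d \<otimes> a [^] (n::nat)" "d \<in> carrier R" "d \<notin> P"
      by (auto simp: S_def)
    have "x \<otimes> y = (c \<otimes> d) \<otimes> a [^] (m + n)"
      using x y ac by (simp add: nat_pow_mult[symmetric] m_ac)
    moreover have "c \<otimes> d \<notin> P"
      using P.I_prime x y by blast
    ultimately show "x \<otimes> y \<in> S"
      using SI x y by simp
  qed
  moreover have "I \<inter> S = {}"
    using no by (auto simp: S_def)
  ultimately obtain Q where Q: "primeideal Q R" "I \<subseteq> Q" "Q \<inter> S = {}"
    using exists_primeideal_disjoint_submonoid[OF I] by blast
  have "Q \<subseteq> P"
  proof
    fix q assume q: "q \<in> Q"
    then have qc: "q \<in> carrier R"
      using Q(1) by (meson primeideal_def ideal.Icarr)
    show "q \<in> P"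
      using SI[OF qc, of 0] qc q Q(3) by auto
  qed
  then have "Q = P" using min Q by blast
  moreover have "a \<in> S"
    using SI[OF one_closed P.one_notin, of 1] ac by simp
  ultimately show False using a Q(3) by blast
qed

text \<open>The product of the individual multipliers serves all of \<open>F\<close>: it stays
  outside the prime \<open>P\<close>, and \<open>I\<close> absorbs the extra factors. The exponents
  may still depend on \<open>a\<close>.\<close>

lemma (in cring) minimal_prime_annihilator_finite:
  assumes I: "ideal I R" and P: "P \<in> Min_primes R I" and F: "finite F" "F \<subseteq> P"
  shows "\<exists>c \<in> carrier R - P. \<forall>a\<in>F. \<exists>n::nat. c \<otimes> a [^] n \<in> I"
proof -
  interpret P: primeideal P R
    using P by (simp add: Min_primes_def Spec_def)
  interpret I: ideal I R by fact
  show ?thesis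
    using F
  proof (induction F rule: finite_induct)
    case empty
    then show ?case using P.one_notin by auto
  next
    case (insert x F)
    obtain c where c: "c \<in> carrier R" "c \<notin> P" "\<forall>a\<in>F. \<exists>n::nat. c \<otimes> a [^] n \<in> I"
      using insert by auto
    obtain d m where d: "d \<in> carrier R" "d \<notin> P" "d \<otimes> x [^] (m::nat) \<in> I"
      using minimal_prime_annihilator[OF I P, of x] insert.prems by auto
    have xc: "x \<in> carrier R" and Fc: "F \<subseteq> carrier R"
      using insert.prems P.Icarr by auto
    have "c \<otimes> d \<notin> P"
      using P.I_prime c d by blast
    moreover have "(c \<otimes> d) \<otimes> x [^] m \<in> I"
      using I.I_l_closed[OF d(3) c(1)] c d xc by (simp add: m_assoc)
    moreover have "\<exists>n::nat. (c \<otimes> d) \<otimes> a [^] n \<in> I" if a: "a \<in> F" for a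
    proof -
      obtain n where n: "c \<otimes> a [^] (n::nat) \<in> I" using c(3) a by blast
      have "d \<otimes> (c \<otimes> a [^] n) \<in> I" using I.I_l_closed[OF n d(1)] .
      moreover have "d \<otimes> (c \<otimes> a [^] n) = (c \<otimes> d) \<otimes> a [^] n"
        using c(1) d(1) a Fc by (simp add: m_ac subset_iff)
      ultimately show ?thesis by auto
    qed
    ultimately show ?case
      using c(1) d(1) by (intro bexI[of _ "c \<otimes> d"]) auto
  qed
qed

text \<open>The multipliers are recorded as a function on \<open>F\<close>, so that a singleton \<open>F\<close> yields a
  singleton image; this lets both parts of the theorem use the same fact.\<close>

lemma (in cring) h_set_shift_minimal_prime:
  assumes Y: "Y \<subseteq> Spec R" and I: "ideal I R" and P: "P \<in> Min_primes R I"
    and F: "finite F" "F \<subseteq> P"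
  obtains c g where "c \<in> carrier R - P" "g ` F \<subseteq> I"
    "\<And>b. \<lbrakk>b \<in> carrier R; h_set Y F \<subseteq> h_set Y {b}\<rbrakk> \<Longrightarrow> h_set Y (g ` F) \<subseteq> h_set Y {c \<otimes> b}"
proof -
  obtain c n where c: "c \<in> carrier R" "c \<notin> P" and n: "\<forall>a\<in>F. c \<otimes> a [^] (n a :: nat) \<in> I"
    using minimal_prime_annihilator_finite[OF I P F] by (metis Diff_iff)
  define g where "g = (\<lambda>a. c \<otimes> a [^] n a)"
  have "P \<subseteq> carrier R"
    using P by (auto simp: Min_primes_def Spec_def primeideal_def dest: ideal.Icarr)
  then have Fc: "F \<subseteq> carrier R" using F by blast
  have "h_set Y (g ` F) \<subseteq> h_set Y {c \<otimes> b}"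
    if b: "b \<in> carrier R" "h_set Y F \<subseteq> h_set Y {b}" for b
  proof
    fix Q assume "Q \<in> h_set Y (g ` F)"
    then have QY: "Q \<in> Y" and gQ: "\<And>a. a \<in> F \<Longrightarrow> c \<otimes> a [^] n a \<in> Q"
      by (auto simp: h_set_def g_def)
    interpret Q: primeideal Q R
      using QY Y by (auto simp: Spec_def)
    \<comment> \<open>If some \<open>a\<close> of \<open>F\<close> is outside \<open>Q\<close>, so
      are all its powers, and primality applied to \<open>c \<otimes> a [^] n a\<close> leaves only
      \<open>c\<close>.\<close>
    have "c \<in> Q \<or> F \<subseteq> Q"
    proof (rule disjCI)
      assume "\<not> F \<subseteq> Q"
      then obtain a where a: "a \<in> F" "a \<notin> Q" by blast
      then have "a \<in> carrier R" using Fc by blast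
      then show "c \<in> Q"
        using gQ[OF a(1)] Q.I_prime[OF c(1)] Q.nat_pow_mem a(2) by blast
    qed
    \<comment> \<open>\<open>F \<subseteq> Q\<close> puts \<open>Q\<close> into
      \<open>h_set Y F\<close>, hence into \<open>h_set Y {b}\<close>.\<close>
    then have "c \<in> Q \<or> b \<in> Q"
      using b(2) QY by (auto simp: h_set_def)
    then have "c \<otimes> b \<in> Q"
      using Q.I_l_closed Q.I_r_closed b(1) c(1) by blast
    then show "Q \<in> h_set Y {c \<otimes> b}"
      using QY by (simp add: h_set_def)
  qed
  then show thesis
    using that[of c g] c n by (auto simp: g_def)
qed

lemma (in cring) minimal_prime_cancel:
  assumes "P \<in> Min_primes R I" "c \<in> carrier R - P" "b \<in> carrier R" "c \<otimes> b \<in> I"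
  shows "b \<in> P"
  using assms primeideal.I_prime[of P R c b] by (auto simp: Min_primes_def Spec_def)

lemma ideal_of_Min_primes: "P \<in> Min_primes R I \<Longrightarrow> ideal P R"
  by (auto simp: Min_primes_def Spec_def primeideal_def)

lemma (in cring) minimal_prime_HY_ideal:
  assumes Y: "Y \<subseteq> Spec R" and P: "P \<in> Min_primes R I" and HI: "HY_ideal R Y I"
  shows "HY_ideal R Y P"
  unfolding HY_ideal_def
proof (intro conjI ballI impI)
  show "ideal P R" using ideal_of_Min_primes[OF P] .
  fix a b assume a: "a \<in> P" and b: "b \<in> carrier R" and h: "h_set Y {a} \<subseteq> h_set Y {b}"
  have I: "ideal I R" using HI by (simp add: HY_ideal_def)
  obtain c g where c: "c \<in> carrier R - P" and g: "g ` {a} \<subseteq> I"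
    and hg: "\<And>b. \<lbrakk>b \<in> carrier R; h_set Y {a} \<subseteq> h_set Y {b}\<rbrakk>
      \<Longrightarrow> h_set Y (g ` {a}) \<subseteq> h_set Y {c \<otimes> b}"
    by (rule h_set_shift_minimal_prime[OF Y I P, of "{a}"]) (use a in auto)
  have "c \<otimes> b \<in> carrier R" using b c by simp
  \<comment> \<open>The image of \<open>{a}\<close> is \<open>{g a}\<close>, so the condition on
    single elements of \<open>I\<close> applies.\<close>
  moreover have "h_set Y {g a} \<subseteq> h_set Y {c \<otimes> b}" using hg[OF b h] by simp
  ultimately have "c \<otimes> b \<in> I"
    using HI g unfolding HY_ideal_def by blast
  then show "b \<in> P" using minimal_prime_cancel[OF P c b] by blast
qed

lemma (in cring) minimal_prime_strong_HY_ideal: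
  assumes Y: "Y \<subseteq> Spec R" and P: "P \<in> Min_primes R I" and HI: "strong_HY_ideal R Y I"
  shows "strong_HY_ideal R Y P"
  unfolding strong_HY_ideal_def
proof (intro conjI allI impI; (elim conjE)?)
  show "ideal P R" using ideal_of_Min_primes[OF P] .
  fix F b assume F: "finite F" "F \<subseteq> P" and b: "b \<in> carrier R" and h: "h_set Y F \<subseteq> h_set Y {b}"
  have I: "ideal I R" using HI by (simp add: strong_HY_ideal_def)
  obtain c g where c: "c \<in> carrier R - P" and g: "g ` F \<subseteq> I"
    and hg: "\<And>b. \<lbrakk>b \<in> carrier R; h_set Y F \<subseteq> h_set Y {b}\<rbrakk>
      \<Longrightarrow> h_set Y (g ` F) \<subseteq> h_set Y {c \<otimes> b}"
    by (rule h_set_shift_minimal_prime[OF Y I P F]) auto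
  have "c \<otimes> b \<in> carrier R" using b c by simp
  \<comment> \<open>\<open>g\<close> applied to \<open>F\<close> gives a finite subset of
    \<open>I\<close>, which serves as the test set in the strong condition on
    \<open>I\<close>.\<close>
  then have "c \<otimes> b \<in> I"
    using HI g hg[OF b h] finite_imageI[OF F(1), of g] unfolding strong_HY_ideal_def by metis
  then show "b \<in> P" using minimal_prime_cancel[OF P c b] by blast
qed

theorem theorem3p13:
  fixes R :: "('a, 'b) ring_scheme" and Y :: "'a set set" and I :: "'a set"
  assumes "cring R"
    and "Y \<subseteq> Spec R"
    and "ideal I R"
  shows "(\<forall>P\<in>Min_primes R I. HY_ideal R Y I \<longrightarrow> HY_ideal R Y P) \<and>
    (\<forall>P\<in>Min_primes R I. strong_HY_ideal R Y I \<longrightarrow> strong_HY_ideal R Y P)"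
  using cring.minimal_prime_HY_ideal[OF assms(1,2)]
    cring.minimal_prime_strong_HY_ideal[OF assms(1,2)] by blast

end
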